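(* Let $(A,F,\mathrm{dist},k)$ be a $k$-median instance, let $\varepsilon>0$, let $\mathcal{L}$ be a $1/\varepsilon$-locally optimal solution and let $C^*$ be any solution. Define $S=\mathcal{L}\cap C^*$, $\tilde{\mathcal{L}}=\mathcal{L}\setminus S$ and $\tilde C^*=C^*\setminus S$. For each client $c$ let $l_c=\min_{\ell\in\mathcal{L}}\mathrm{dist}(c,\ell)$ and $g_c=\min_{f\in C^*}\mathrm{dist}(c,f)$. Then $$\sum_{c\in N_{C^*}(\tilde C^* )\setminus N_{\mathcal{L}}(\tilde{\mathcal{L}})} l_c+\sum_{c\in N_{\mathcal{L}}(\tilde{\mathcal{L}})} l_c\le\sum_{c\in N_{C^*}(\tilde C^* )\setminus N_{\mathcal{L}}(\tilde{\mathcal{L}})} g_c+(3+2\varepsilon)\sum_{c\in N_{\mathcal{L}}(\tilde{\mathcal{L}})} g_c.$$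
   Context: $k$-median: clients $A$ and candidate centers $F$ in a metric space with metric $\mathrm{dist}$; a solution is a set $S\subseteq F$ with $|S|\le k$, of cost $\mathrm{cost}(S)=\sum_{x\in A}\min_{c\in S}\mathrm{dist}(x,c)$. A solution $S_0$ is $1/\varepsilon$-locally optimal if every solution $S_1$ with $|S_0\setminus S_1|+|S_1\setminus S_0|\le 2/\varepsilon$ has $\mathrm{cost}(S_1)\ge\mathrm{cost}(S_0)$. For a set of centers $T$ and $T_0\subseteq T$, $N_T(T_0)=\{x\in A:\exists s\in T_0,\ \mathrm{dist}(x,s)=\min_{s'\in T}\mathrm{dist}(x,s')\}$ is the set of clients served by a center of $T_0$ in solution $T$.
   Formalization: The inequality is proved only when 1/ε is a positive integer; for other ε > 0 it is false as stated, because a difference of at most 2/ε allows only ⌊1/ε⌋ swaps while the bound uses 1/ε itself. *)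

theory Defs
  imports "HOL-Analysis.Analysis"
begin

definition min_dist :: "'a::metric_space set \<Rightarrow> 'a \<Rightarrow> real" where
  "min_dist T x = (MIN c\<in>T. dist x c)"

definition kmed_cost :: "'a::metric_space set \<Rightarrow> 'a set \<Rightarrow> real" where
  "kmed_cost A T = (\<Sum>x\<in>A. min_dist T x)"

text \<open>Solutions are finite (\<^const>\<open>card\<close> is 0 on infinite sets) and nonempty
  (the minimum over the empty set, hence the cost of the empty set, is unspecified).\<close>

definition kmed_solution :: "'a set \<Rightarrow> nat \<Rightarrow> 'a set \<Rightarrow> bool" where
  "kmed_solution F k T \<longleftrightarrow> T \<subseteq> F \<and> finite T \<and> T \<noteq> {} \<and> card T \<le> k"

text \<open>\<open>locally_optimal A F k \<epsilon> T\<close> says that \<open>T\<close> is \<open>1/\<epsilon>\<close>-locally optimal.\<close>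

definition locally_optimal ::
    "'a::metric_space set \<Rightarrow> 'a set \<Rightarrow> nat \<Rightarrow> real \<Rightarrow> 'a set \<Rightarrow> bool" where
  "locally_optimal A F k \<epsilon> T \<longleftrightarrow>
     kmed_solution F k T \<and>
     (\<forall>T'. kmed_solution F k T' \<and> real (card (T - T') + card (T' - T)) \<le> 2 / \<epsilon>
        \<longrightarrow> kmed_cost A T' \<ge> kmed_cost A T)"

text \<open>A client at the same minimal distance from several centers of \<open>T\<close> is served by all of them.\<close>

definition served :: "'a::metric_space set \<Rightarrow> 'a set \<Rightarrow> 'a set \<Rightarrow> 'a set" where
  "served A T T0 = {x \<in> A. \<exists>s\<in>T0. dist x s = min_dist T x}"

end

theory Submission
  imports Defs
begin

text \<open>
  Let \<open>p = 1 / \<epsilon>\<close>, and let \<open>\<eta> f\<close> be a center of \<open>L\<close> nearest to the center \<open>f\<close> of \<open>C\<close>. Consider a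
  swap that replaces \<open>P \<subseteq> L'\<close> by \<open>Q \<subseteq> C'\<close> such that \<open>Q\<close> contains all \<open>f\<close> with \<open>\<eta> f \<in> P\<close>. A client
  served by \<open>Q\<close> in \<open>C\<close> moves to its center in \<open>C\<close>; any other client that loses its center in \<open>L\<close>
  moves to \<open>\<eta> f\<close>, where \<open>f\<close> is its center in \<open>C\<close>, at an extra cost of at most \<open>2 g\<close>. Local
  optimality bounds the total change from below by 0. One then averages over a weighted family of
  swaps of size at most \<open>p\<close> in which every center of \<open>C'\<close> has total weight 1 and every center of
  \<open>L'\<close> has total weight at most \<open>1 + 1 / p\<close>. Finally, a client served by \<open>L'\<close> in \<open>L\<close> but not by
  \<open>C'\<close> in \<open>C\<close> has its \<open>C\<close>-center in \<open>L\<close>, so \<open>l \<le> g\<close> there.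
\<close>

section \<open>Distances to a finite set of centers, and sums over fibres\<close>

lemma min_dist_le: "finite T \<Longrightarrow> s \<in> T \<Longrightarrow> min_dist T x \<le> dist x s"
  unfolding min_dist_def by (intro Min_le) auto

lemma min_dist_attained:
  assumes "finite T" "T \<noteq> {}"
  obtains s where "s \<in> T" "dist x s = min_dist T x"
proof -
  have "min_dist T x \<in> dist x ` T"
    unfolding min_dist_def using assms by (intro Min_in) auto
  then show thesis using that by force
qed

lemma min_dist_nonneg:
  assumes "finite T" "T \<noteq> {}"
  shows "0 \<le> min_dist T x"
  by (metis assms min_dist_attained zero_le_dist)

text \<open>Passes between totals per center, which the averaging weights, and totals per client, in
  which cost changes are estimated.\<close>

lemma sum_fibres:
  fixes u :: "'a \<Rightarrow> real"
  assumes "finite A" "finite Q"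
  shows "(\<Sum>q\<in>Q. \<Sum>c | c \<in> A \<and> f c = q. u c) = (\<Sum>c\<in>A. if f c \<in> Q then u c else 0)"
proof -
  have "(\<Sum>q\<in>Q. \<Sum>c | c \<in> A \<and> f c = q. u c) = (\<Sum>q\<in>Q. \<Sum>c\<in>A. if f c = q then u c else 0)"
    using assms(1) by (simp add: sum.inter_filter)
  also have "\<dots> = (\<Sum>c\<in>A. \<Sum>q\<in>Q. if f c = q then u c else 0)"
    by (rule sum.swap)
  also have "\<dots> = (\<Sum>c\<in>A. if f c \<in> Q then u c else 0)"
    using assms(2) by (simp add: sum.delta)
  finally show ?thesis .
qed

section \<open>Cost change of a single swap\<close>

lemma locally_optimal_swap:
  fixes A F L C P Q :: "'a::metric_space set"
    and oc \<sigma> \<eta> :: "'a \<Rightarrow> 'a"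
  assumes A: "finite A"
    and opt: "locally_optimal A F k \<epsilon> L"
    and sol: "kmed_solution F k C"
    and oc: "\<And>c. oc c \<in> C \<and> dist c (oc c) = min_dist C c"
    and \<sigma>: "\<And>c. \<sigma> c \<in> L \<and> dist c (\<sigma> c) = min_dist L c"
    and \<eta>: "\<And>f. \<eta> f \<in> L \<and> dist f (\<eta> f) = min_dist L f"
    and P: "P \<subseteq> L - C" and Q: "Q \<subseteq> C - L" "Q \<noteq> {}"
    and size: "real (card P + card Q) \<le> 2 / \<epsilon>"
    and le_k: "card L + card Q \<le> k + card P"
    and closed: "\<And>f. f \<in> C - L \<Longrightarrow> \<eta> f \<in> P \<Longrightarrow> f \<in> Q"
  shows "0 \<le> (\<Sum>f\<in>Q. \<Sum>c | c \<in> A \<and> oc c = f. min_dist C c - min_dist L c)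
             + (\<Sum>s\<in>P. \<Sum>c | c \<in> A \<and> \<sigma> c = s. 2 * min_dist C c)"
proof -
  define T where "T = (L - P) \<union> Q"
  have L: "finite L" "L \<noteq> {}" "L \<subseteq> F" "card L \<le> k"
    using opt by (auto simp: locally_optimal_def kmed_solution_def)
  have C: "finite C" "C \<noteq> {}" "C \<subseteq> F" "card C \<le> k"
    using sol by (auto simp: kmed_solution_def)
  have fin: "finite P" "finite Q"
    using P Q L C by (auto intro: finite_subset)
  have T: "finite T" using L fin by (simp add: T_def)
  have diffs: "L - T = P" "T - L = Q"
    using P Q by (auto simp: T_def)
  have PL: "card P \<le> card L" using P L by (intro card_mono) auto
  have "card T = card (L - P) + card Q"
    unfolding T_def using Q L fin by (intro card_Un_disjoint) auto
  also have "card (L - P) = card L - card P"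
    using P fin by (intro card_Diff_subset) auto
  finally have "card T \<le> k" using le_k PL by linarith
  then have "kmed_solution F k T"
    using T Q L C P unfolding kmed_solution_def by (auto simp: T_def)
  then have "kmed_cost A L \<le> kmed_cost A T"
    using opt size diffs unfolding locally_optimal_def by auto
  then have "0 \<le> (\<Sum>c\<in>A. min_dist T c - min_dist L c)"
    by (simp add: kmed_cost_def sum_subtractf)
  \<comment> \<open>A client with \<open>oc c \<in> Q\<close> and \<open>\<sigma> c \<in> P\<close>
    is charged twice; its second charge is nonnegative slack.\<close>
  also have "\<dots> \<le> (\<Sum>c\<in>A. (if oc c \<in> Q then min_dist C c - min_dist L c else 0)
                         + (if \<sigma> c \<in> P then 2 * min_dist C c else 0))"
  proof (rule sum_mono)
    fix c
    have g: "0 \<le> min_dist C c" using C by (intro min_dist_nonneg)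
    consider "oc c \<in> Q" | "oc c \<notin> Q" "\<sigma> c \<notin> P" | "oc c \<notin> Q" "\<sigma> c \<in> P" by blast
    then show "min_dist T c - min_dist L c
        \<le> (if oc c \<in> Q then min_dist C c - min_dist L c else 0)
           + (if \<sigma> c \<in> P then 2 * min_dist C c else 0)"
    proof cases
      case 1
      then have "min_dist T c \<le> dist c (oc c)" using T by (intro min_dist_le) (auto simp: T_def)
      then show ?thesis using 1 g oc[of c] by auto
    next
      case 2
      then have "min_dist T c \<le> dist c (\<sigma> c)"
        using T \<sigma>[of c] by (intro min_dist_le) (auto simp: T_def)
      then show ?thesis using 2 \<sigma>[of c] by auto
    next
      case 3
      \<comment> \<open>The fallback center stays open: if \<open>oc c\<close> lies in
        \<open>L\<close>, it is its own nearest center and \<open>P\<close> avoids \<open>C\<close>;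
        otherwise \<open>closed\<close> applies.\<close>
      have "\<eta> (oc c) \<notin> P"
      proof (cases "oc c \<in> L")
        case True
        then have "dist (oc c) (\<eta> (oc c)) \<le> dist (oc c) (oc c)"
          using \<eta> min_dist_le[OF L(1)] by metis
        then have "\<eta> (oc c) = oc c" by simp
        then show ?thesis using P oc[of c] by auto
      next
        case False
        then show ?thesis using closed[of "oc c"] 3 oc[of c] by auto
      qed
      then have "min_dist T c \<le> dist c (\<eta> (oc c))"
        using T \<eta>[of "oc c"] by (intro min_dist_le) (auto simp: T_def)
      also have "\<dots> \<le> dist c (oc c) + dist (oc c) (\<eta> (oc c))" by (rule dist_triangle)
      also have "dist (oc c) (\<eta> (oc c)) \<le> dist (oc c) (\<sigma> c)"
        using \<eta>[of "oc c"] \<sigma>[of c] min_dist_le[OF L(1)] by metis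
      also have "\<dots> \<le> dist c (oc c) + dist c (\<sigma> c)" by (rule dist_triangle3)
      finally show ?thesis using 3 oc[of c] \<sigma>[of c] by auto
    qed
  qed
  also have "\<dots> = (\<Sum>f\<in>Q. \<Sum>c | c \<in> A \<and> oc c = f. min_dist C c - min_dist L c)
             + (\<Sum>s\<in>P. \<Sum>c | c \<in> A \<and> \<sigma> c = s. 2 * min_dist C c)"
    by (simp add: sum.distrib sum_fibres A fin)
  finally show ?thesis .
qed

section \<open>Averaging over a weighted family of swaps\<close>

text \<open>
  The number \<open>m\<close> is the slack \<open>k - card L\<close>. Choose one element \<open>r s\<close> in each nonempty fibre of \<open>\<eta>\<close>
  over \<open>L'\<close>, and match the other elements of \<open>C'\<close> injectively to elements of \<open>L'\<close> with empty fibre,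
  leaving at most \<open>m\<close> of them unmatched. A fibre with \<open>t \<le> p\<close> elements is swapped as a whole, for \<open>s\<close>
  and the partners of the fibre. If \<open>t > p\<close>, each of its elements is swapped for each of the \<open>t - 1\<close>
  partners with weight \<open>1 / (t - 1)\<close>, so that a partner has weight \<open>t / (t - 1) \<le> 1 + 1 / p\<close>.
\<close>

lemma swap_averaging:
  fixes a :: "'a \<Rightarrow> real" and b :: "'b \<Rightarrow> real" and \<eta> :: "'a \<Rightarrow> 'b"
  assumes fin: "finite L'" "finite C'"
    and b: "\<And>s. 0 \<le> b s"
    and p: "1 \<le> p"
    and card_le: "card C' \<le> card L' + m"
    and swap: "\<And>P Q. P \<subseteq> L' \<Longrightarrow> Q \<subseteq> C' \<Longrightarrow> Q \<noteq> {} \<Longrightarrow> card P + card Q \<le> 2 * p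
        \<Longrightarrow> card Q \<le> card P + m \<Longrightarrow> (\<And>f. f \<in> C' \<Longrightarrow> \<eta> f \<in> P \<Longrightarrow> f \<in> Q)
        \<Longrightarrow> 0 \<le> sum a Q + sum b P"
  shows "0 \<le> sum a C' + (1 + 1 / real p) * sum b L'"
proof -
  define pos where "pos = \<eta> ` C' \<inter> L'"
  define r where "r = inv_into C' \<eta>"
  define R where "R = C' - r ` pos"
  define Z where "Z = L' - pos"
  have r: "r s \<in> C'" "\<eta> (r s) = s" if "s \<in> pos" for s
    using that by (auto simp: r_def pos_def inv_into_into f_inv_into_f)
  have inj_r: "inj_on r pos" by (rule inj_on_inverseI[of _ \<eta>]) (simp add: r)
  have fin': "finite pos" "finite R" "finite Z"
    using fin by (auto simp: pos_def R_def Z_def)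
  have cR: "card R + card pos = card C'"
  proof -
    have sub: "r ` pos \<subseteq> C'" using r by auto
    then have "card R = card C' - card (r ` pos)"
      unfolding R_def using fin' by (intro card_Diff_subset) auto
    moreover have "card (r ` pos) \<le> card C'" using sub fin by (intro card_mono)
    moreover have "card (r ` pos) = card pos" using inj_r by (rule card_image)
    ultimately show ?thesis by linarith
  qed
  have cZ: "card Z + card pos = card L'"
  proof -
    have "pos \<subseteq> L'" by (simp add: pos_def)
    then show ?thesis unfolding Z_def
      using fin fin' by (metis card_Diff_subset card_mono le_add_diff_inverse2)
  qed
  \<comment> \<open>\<open>R0\<close> is the matched part of \<open>R\<close>. Both \<open>R\<close>
    and \<open>Z\<close> arise by discarding \<open>card pos\<close> elements, so \<open>R\<close>
    exceeds \<open>Z\<close> by at most \<open>m\<close>.\<close>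
  obtain R0 where R0: "R0 \<subseteq> R" "card R0 \<le> card Z" "card (R - R0) \<le> m"
  proof (cases "card R \<le> card Z")
    case True
    then show thesis using that[of R] by simp
  next
    case False
    then obtain R0 where "R0 \<subseteq> R" "card R0 = card Z"
      by (meson nat_le_linear obtain_subset_with_card_n)
    moreover have "card (R - R0) = card R - card R0"
      using calculation fin' by (intro card_Diff_subset) (auto intro: finite_subset)
    ultimately show thesis using that[of R0] cR cZ card_le by linarith
  qed
  have finR0: "finite R0" using R0 fin' finite_subset by blast
  obtain h where h: "h ` R0 \<subseteq> Z" "inj_on h R0"
    using card_le_inj[OF finR0 fin'(3) R0(2)] by auto
  \<comment> \<open>The weight of the partner of \<open>f\<close>, and 0 if \<open>f\<close> is
    unmatched.\<close>
  define hb where "hb f = sum b (h ` ({f} \<inter> R0))" for f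
  have hb_nonneg: "0 \<le> hb f" for f
    unfolding hb_def by (intro sum_nonneg b)
  have hb_sum: "sum hb X = sum b (h ` (X \<inter> R0))" if "finite X" for X
  proof -
    have "sum hb X = (\<Sum>f\<in>X. if f \<in> R0 then b (h f) else 0)"
      by (intro sum.cong) (auto simp: hb_def)
    also have "\<dots> = (\<Sum>f\<in>X \<inter> R0. b (h f))"
      using that by (simp add: sum.inter_restrict)
    also have "\<dots> = sum b (h ` (X \<inter> R0))"
      using h(2) by (subst sum.reindex) (auto intro: inj_on_subset)
    finally show ?thesis .
  qed
  have slack: "card X \<le> card (h ` (X \<inter> R0)) + m" if "X \<subseteq> R" for X
  proof -
    have finX: "finite X" using that fin' finite_subset by blast
    have "card X = card (X \<inter> R0) + card (X - R0)"
      using finX by (metis card_Int_Diff)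
    also have "card (X - R0) \<le> card (R - R0)"
      using that fin' by (intro card_mono) auto
    also have "card (X \<inter> R0) = card (h ` (X \<inter> R0))"
      using h(2) by (subst card_image) (auto intro: inj_on_subset)
    finally show ?thesis using R0 by linarith
  qed
  have image_le: "card (h ` (X \<inter> R0)) \<le> card X" if "finite X" for X
    using that by (meson card_image_le card_mono finite_Int inf_le1 le_trans)
  have hZ: "h f \<in> L'" "h f \<notin> \<eta> ` C'" if "f \<in> R0" for f
    using h(1) that by (auto simp: Z_def pos_def)
  \<comment> \<open>Partners have empty fibres, so closedness is vacuous. If \<open>z\<close> is
    unmatched, the swap is a pure insertion, paid for by the slack \<open>m\<close>.\<close>
  have single: "0 \<le> a f + hb z" if "f \<in> C'" "z \<in> R" for f z
  proof -
    have "0 \<le> sum a {f} + sum b (h ` ({z} \<inter> R0))"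
    proof (rule swap)
      show "card (h ` ({z} \<inter> R0)) + card {f} \<le> 2 * p"
        using image_le[of "{z}"] p by auto
      show "card {f} \<le> card (h ` ({z} \<inter> R0)) + m"
        using slack[of "{z}"] that by auto
      show "f' \<in> {f}" if "f' \<in> C'" "\<eta> f' \<in> h ` ({z} \<inter> R0)" for f'
        using that hZ(2) by (metis IntE imageE imageI)
    qed (use that hZ in auto)
    then show ?thesis by (simp add: hb_def)
  qed
  have inv_p: "0 \<le> 1 / real p" by simp
  have fibre: "0 \<le> (\<Sum>f | f \<in> C' \<and> \<eta> f = s. a f)
      + (1 + 1 / real p) * (b s + (\<Sum>f | f \<in> R \<and> \<eta> f = s. hb f))" if s: "s \<in> pos" for s
  proof -
    define Q where "Q = {f. f \<in> C' \<and> \<eta> f = s}"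
    define X where "X = {f. f \<in> R \<and> \<eta> f = s}"
    have rimg: "f = r s" if "f \<in> r ` pos" "\<eta> f = s" for f
      using that r by auto
    have QX: "Q = insert (r s) X" "r s \<notin> X"
      using r[OF s] s rimg by (auto simp: Q_def X_def R_def)
    have finX: "finite X" "finite Q" using fin fin' by (auto simp: X_def Q_def)
    have XR: "X \<subseteq> R" by (auto simp: X_def)
    \<comment> \<open>The representative \<open>r s\<close> has no partner. In a small fibre
      \<open>s\<close> itself is removed in exchange for it.\<close>
    have cQ: "card Q = Suc (card X)" using QX finX by simp
    have hX: "0 \<le> sum hb X" by (intro sum_nonneg hb_nonneg)
    show ?thesis
    proof (cases "card Q \<le> p")
      case True
      define P where "P = insert s (h ` (X \<inter> R0))"
      have "s \<in> \<eta> ` C'" "s \<in> L'" using s by (auto simp: pos_def)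
      then have notin: "s \<notin> h ` (X \<inter> R0)" using hZ(2) by blast
      have cP: "card P = Suc (card (h ` (X \<inter> R0)))"
        using notin finX by (simp add: P_def)
      have "0 \<le> sum a Q + sum b P"
      proof (rule swap)
        show "P \<subseteq> L'" using \<open>s \<in> L'\<close> hZ by (auto simp: P_def)
        show "Q \<subseteq> C'" "Q \<noteq> {}" using QX by (auto simp: Q_def)
        show "card P + card Q \<le> 2 * p"
          using cP cQ True image_le[OF finX(1)] by linarith
        show "card Q \<le> card P + m" using cP cQ slack[OF XR] by linarith
        show "f \<in> Q" if "f \<in> C'" "\<eta> f \<in> P" for f
        proof -
          have "\<eta> f \<notin> h ` (X \<inter> R0)" using that(1) hZ(2) by (metis IntE imageE imageI)
          then show ?thesis using that by (auto simp: P_def Q_def)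
        qed
      qed
      also have "sum b P = b s + sum hb X"
        using notin finX by (simp add: P_def hb_sum)
      also have "\<dots> \<le> (1 + 1 / real p) * (b s + sum hb X)"
        using b[of s] hX inv_p by (simp add: distrib_right)
      finally show ?thesis by (simp add: Q_def X_def)
    next
      case False
      \<comment> \<open>Here \<open>t\<close> counts the fibre without its representative, one less
        than the fibre size; hence \<open>t \<ge> p\<close> and the partner weight is
        \<open>(t + 1) / t\<close>.\<close>
      define t where "t = real (card X)"
      have t: "real p \<le> t" "0 < t" using False cQ p by (auto simp: t_def)
      have "0 \<le> (\<Sum>f\<in>Q. \<Sum>z\<in>X. a f + hb z)"
        using single XR by (intro sum_nonneg) (auto simp: Q_def)
      also have "\<dots> = t * sum a Q + (t + 1) * sum hb X"
        by (simp add: sum.distrib t_def cQ sum_distrib_left add.commute)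
      also have "\<dots> = t * (sum a Q + (1 + 1 / t) * sum hb X)"
        using t by (simp add: field_simps)
      finally have "0 \<le> sum a Q + (1 + 1 / t) * sum hb X"
        using t by (simp add: zero_le_mult_iff)
      also have "\<dots> \<le> sum a Q + (1 + 1 / real p) * (b s + sum hb X)"
        using t p b[of s] hX
        by (intro add_left_mono mult_mono) (auto simp: frac_le)
      finally show ?thesis by (simp add: Q_def X_def)
    qed
  qed
  have split: "sum u Y = (\<Sum>s\<in>pos. \<Sum>f | f \<in> Y \<and> \<eta> f = s. u f) + (\<Sum>f | f \<in> Y \<and> \<eta> f \<notin> L'. u f)"
    if "Y \<subseteq> C'" for u :: "'a \<Rightarrow> real" and Y
  proof -
    have finY: "finite Y" using that fin finite_subset by blast
    have "(\<Sum>s\<in>pos. \<Sum>f | f \<in> Y \<and> \<eta> f = s. u f) = (\<Sum>f\<in>Y. if \<eta> f \<in> pos then u f else 0)"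
      using finY fin' by (intro sum_fibres)
    moreover have "(\<Sum>f | f \<in> Y \<and> \<eta> f \<notin> L'. u f) = (\<Sum>f\<in>Y. if \<eta> f \<notin> L' then u f else 0)"
      using finY by (rule sum.inter_filter)
    moreover have "sum u Y = (\<Sum>f\<in>Y. (if \<eta> f \<in> pos then u f else 0)
        + (if \<eta> f \<notin> L' then u f else 0))"
      using that by (intro sum.cong) (auto simp: pos_def)
    ultimately show ?thesis by (simp add: sum.distrib)
  qed
  \<comment> \<open>Centers with \<open>\<eta> f\<close> outside \<open>L'\<close> are never
    representatives; each is swapped with its own partner, if any.\<close>
  have outside: "{f. f \<in> C' \<and> \<eta> f \<notin> L'} = {f. f \<in> R \<and> \<eta> f \<notin> L'}"
    using r by (auto simp: R_def pos_def)
  have "0 \<le> (\<Sum>s\<in>pos. (\<Sum>f | f \<in> C' \<and> \<eta> f = s. a f)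
        + (1 + 1 / real p) * (b s + (\<Sum>f | f \<in> R \<and> \<eta> f = s. hb f)))
      + (\<Sum>f | f \<in> R \<and> \<eta> f \<notin> L'. a f + (1 + 1 / real p) * hb f)"
  proof (rule add_nonneg_nonneg; rule sum_nonneg)
    fix f assume "f \<in> {f. f \<in> R \<and> \<eta> f \<notin> L'}"
    then have "0 \<le> a f + hb f" by (intro single) (auto simp: R_def)
    also have "\<dots> \<le> a f + (1 + 1 / real p) * hb f"
      using hb_nonneg[of f] inv_p by (simp add: distrib_right)
    finally show "0 \<le> a f + (1 + 1 / real p) * hb f" .
  qed (rule fibre)
  also have "\<dots> = sum a C' + (1 + 1 / real p) * (sum b pos + sum hb R)"
    using split[of C' a] split[of R hb]
    by (simp add: outside R_def sum.distrib sum_distrib_left[symmetric] distrib_left)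
  also have "sum b pos + sum hb R \<le> sum b L'"
  proof -
    have "sum hb R = sum b (h ` R0)"
      using hb_sum[OF fin'(2)] R0 by (simp add: Int_absorb1)
    also have "\<dots> \<le> sum b Z" using h fin' b by (intro sum_mono2) auto
    also have "sum b pos + sum b Z = sum b L'"
      unfolding Z_def using fin by (metis pos_def add.commute inf_le2 sum.subset_diff)
    finally show ?thesis by simp
  qed
  finally show ?thesis by (simp add: mult_left_mono)
qed

section \<open>From the averaged swaps to the bound\<close>

theorem theorem3:
  fixes A F L C S L' C' :: "'a::metric_space set"
    and k :: nat and \<epsilon> :: real and l g :: "'a \<Rightarrow> real"
  assumes "finite A"
    and "\<epsilon> > 0" and "1 / \<epsilon> \<in> \<nat>"
    and "locally_optimal A F k \<epsilon> L"
    and "kmed_solution F k C"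
  defines "S \<equiv> L \<inter> C"
    and "L' \<equiv> L - S"
    and "C' \<equiv> C - S"
    and "l \<equiv> min_dist L"
    and "g \<equiv> min_dist C"
  shows "(\<Sum>c\<in>served A C C' - served A L L'. l c) + (\<Sum>c\<in>served A L L'. l c)
       \<le> (\<Sum>c\<in>served A C C' - served A L L'. g c)
           + (3 + 2 * \<epsilon>) * (\<Sum>c\<in>served A L L'. g c)"
proof -
  have L: "finite L" "L \<noteq> {}" "L \<subseteq> F" "card L \<le> k"
    using assms(4) by (auto simp: locally_optimal_def kmed_solution_def)
  have C: "finite C" "C \<noteq> {}" "C \<subseteq> F" "card C \<le> k"
    using assms(5) by (auto simp: kmed_solution_def)
  have L'_eq: "L' = L - C" and C'_eq: "C' = C - L" by (auto simp: L'_def C'_def S_def)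
  obtain p :: nat where p: "1 / \<epsilon> = real p" using assms(3) by (auto elim: Nats_cases)
  then have "\<epsilon> = 1 / real p" by (metis inverse_eq_divide inverse_inverse_eq)
  moreover have "2 / \<epsilon> = real (2 * p)" using p by simp
  ultimately have \<epsilon>: "\<epsilon> = 1 / real p" "2 / \<epsilon> = real (2 * p)" .
  have p1: "1 \<le> p" using p assms(2) by (cases p) (auto simp: field_simps)
  have g0: "0 \<le> g c" for c unfolding g_def using C by (intro min_dist_nonneg)
  have "\<exists>s. s \<in> L \<and> dist c s = min_dist L c" for c using min_dist_attained[OF L(1,2)] by metis
  then obtain \<sigma> where \<sigma>: "\<And>c. \<sigma> c \<in> L \<and> dist c (\<sigma> c) = min_dist L c" by metis
  \<comment> \<open>Ties in \<open>C\<close> are broken in favour of \<open>C'\<close>.\<close>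
  have "\<exists>f. f \<in> C \<and> dist c f = min_dist C c \<and> (c \<in> served A C C' \<longrightarrow> f \<in> C')" for c
  proof (cases "c \<in> served A C C'")
    case True
    then show ?thesis by (auto simp: served_def C'_eq)
  next
    case False
    then show ?thesis using min_dist_attained[OF C(1,2)] by metis
  qed
  then obtain oc where oc: "\<And>c. oc c \<in> C \<and> dist c (oc c) = min_dist C c"
    and oc': "\<And>c. c \<in> served A C C' \<Longrightarrow> oc c \<in> C'" by metis
  have oc_iff: "oc c \<in> C' \<longleftrightarrow> c \<in> served A C C'" if "c \<in> A" for c
    using oc[of c] oc'[of c] that by (auto simp: served_def)
  define a where "a f = (\<Sum>c | c \<in> A \<and> oc c = f. g c - l c)" for f
  define b where "b s = (\<Sum>c | c \<in> A \<and> \<sigma> c = s. 2 * g c)" for s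
  have fin: "finite L'" "finite C'" using L C by (auto simp: L'_eq C'_eq)
  have "card L = card L' + card (L \<inter> C)" "card C = card C' + card (L \<inter> C)"
    using L C card_Int_Diff[of L C] card_Int_Diff[of C L] by (auto simp: L'_eq C'_eq Int_commute)
  then have cards: "card C' \<le> card L' + (k - card L)" using L C by linarith
  have avg: "0 \<le> sum a C' + (1 + 1 / real p) * sum b L'"
  \<comment> \<open>\<open>\<sigma>\<close> picks a nearest center of \<open>L\<close> for every
    point, so it serves both as the client assignment and as \<open>\<eta>\<close>.\<close>
  proof (rule swap_averaging[OF fin _ p1 cards, where \<eta> = \<sigma>])
    show "0 \<le> b s" for s unfolding b_def by (intro sum_nonneg) (simp add: g0)
  next
    fix P Q
    assume PQ: "P \<subseteq> L'" "Q \<subseteq> C'" "Q \<noteq> {}" "card P + card Q \<le> 2 * p"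
      "card Q \<le> card P + (k - card L)" "\<And>f. f \<in> C' \<Longrightarrow> \<sigma> f \<in> P \<Longrightarrow> f \<in> Q"
    show "0 \<le> sum a Q + sum b P"
      unfolding a_def b_def g_def l_def
    proof (rule locally_optimal_swap[OF assms(1,4,5) oc \<sigma> \<sigma>])
      show "real (card P + card Q) \<le> 2 / \<epsilon>"
        unfolding \<epsilon>(2) using PQ(4) by (rule of_nat_mono)
      show "card L + card Q \<le> k + card P" using PQ(5) L(4) by linarith
    qed (use PQ in \<open>auto simp: L'_eq C'_eq\<close>)
  qed
  define X Y where "X = served A C C'" and "Y = served A L L'"
  have XY: "finite X" "finite Y" "X \<subseteq> A" "Y \<subseteq> A"
    using assms(1) by (auto simp: X_def Y_def served_def)
  have "sum a C' = (\<Sum>c\<in>A. if oc c \<in> C' then g c - l c else 0)"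
    unfolding a_def using assms(1) fin by (intro sum_fibres)
  also have "\<dots> = (\<Sum>c\<in>A. if c \<in> X then g c - l c else 0)"
    by (intro sum.cong) (auto simp: oc_iff X_def)
  also have "\<dots> = (\<Sum>c\<in>X. g c - l c)"
    using assms(1) XY by (simp add: sum.inter_restrict[symmetric] Int_absorb1)
  also have "\<dots> = (\<Sum>c\<in>X - Y. g c - l c) + (\<Sum>c\<in>X \<inter> Y. g c - l c)"
    using XY by (metis add.commute sum.Int_Diff)
  also have "(\<Sum>c\<in>X \<inter> Y. g c - l c) \<le> (\<Sum>c\<in>Y. g c - l c)"
  proof (rule sum_mono2)
    fix c assume c: "c \<in> Y - X \<inter> Y"
    then have "oc c \<notin> C'" using XY oc_iff[of c] by (auto simp: X_def)
    then have "oc c \<in> L" using oc[of c] by (auto simp: C'_eq)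
    then have "l c \<le> g c" unfolding l_def g_def using oc[of c] min_dist_le[OF L(1)] by metis
    then show "0 \<le> g c - l c" by simp
  qed (use XY in auto)
  finally have a_le: "sum a C' \<le> (\<Sum>c\<in>X - Y. g c - l c) + (\<Sum>c\<in>Y. g c - l c)" by simp
  have "sum b L' = (\<Sum>c\<in>A. if \<sigma> c \<in> L' then 2 * g c else 0)"
    unfolding b_def using assms(1) fin by (intro sum_fibres)
  \<comment> \<open>Ties in \<open>L\<close> may send a client of \<open>Y\<close> to a center
    outside \<open>L'\<close>; an inequality suffices, since \<open>g\<close> is
    nonnegative.\<close>
  also have "\<dots> \<le> (\<Sum>c\<in>A. if c \<in> Y then 2 * g c else 0)"
    using \<sigma> g0 by (intro sum_mono) (auto simp: Y_def served_def)
  also have "\<dots> = 2 * (\<Sum>c\<in>Y. g c)"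
    using assms(1) XY by (simp add: sum.inter_restrict[symmetric] Int_absorb1 sum_distrib_left)
  finally have "(1 + \<epsilon>) * sum b L' \<le> (1 + \<epsilon>) * (2 * (\<Sum>c\<in>Y. g c))"
    using assms(2) by (intro mult_left_mono) auto
  \<comment> \<open>The constant arises as
    \<open>3 + 2 * \<epsilon> = 1 + 2 * (1 + \<epsilon>)\<close>.\<close>
  then have "0 \<le> (\<Sum>c\<in>X - Y. g c - l c) + (\<Sum>c\<in>Y. g c - l c) + (1 + \<epsilon>) * (2 * (\<Sum>c\<in>Y. g c))"
    using avg a_le \<epsilon>(1) by simp
  then show ?thesis
    by (simp add: X_def Y_def sum_subtractf algebra_simps)
qed

end
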